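(* Let $d\ge1$ and $a\in[0,1]$. Suppose there exists a bounded function $f:\mathbb{Z}\to\mathbb{R}$ such that for all $m\in\mathbb{Z}$, $$\sum_{i=0}^{d}(-1)^{d-i}\binom{d}{i}f(m+i)\in\{a,a-1\}.$$ Then there exists a balanced word $w\in\{0,1\}^{\mathbb{Z}^d}$ with density $a$.
   Context: The displayed quantity is $((u-1)^d\cdot f)(m)$, where a polynomial $p=\sum_g c_g u^g$ acts on functions by $(p\cdot f)(x)=\sum_g c_g f(x+g)$. For integers $a\le b$, $[a,b)$ denotes $\{a,a+1,\ldots,b-1\}$. A rectangle in $\mathbb{Z}^d$ is a set of the form $[a_1,b_1)\times\cdots\times[a_d,b_d)$ with integers $a_i\le b_i$. For $w\in\{0,1\}^{\mathbb{Z}^d}$, let $S_w=\{g\in\mathbb{Z}^d : w(g)=1\}$. A word $w\in\{0,1\}^{\mathbb{Z}^d}$ is balanced if there exists $M>0$ such that for any two rectangles $R,R'\subset\mathbb{Z}^d$ that are translates of each other, $\big||S_w\cap R|-|S_w\cap R'|\big|\le M$. A word $w$ has density $a\in[0,1]$ if $|S_w\cap R_n|/|R_n|\to a$ as $n\to\infty$ for every sequence of rectangles $(R_n)$ with $|R_n|\to\infty$. *)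

theory Defs
  imports "HOL-Analysis.Analysis"
begin

text \<open>
  The group \<open>\<int>\<^sup>d\<close> is rendered as \<^typ>\<open>int ^ 'd\<close> for a finite index type \<open>'d\<close>, so that
  \<open>d = CARD('d)\<close>; since types are nonempty, \<open>d \<ge> 1\<close> holds automatically.
\<close>

definition box_int :: "int ^ 'd \<Rightarrow> int ^ 'd \<Rightarrow> (int ^ 'd) set" where
  "box_int a b = {x. \<forall>i. x $ i \<in> {a $ i ..< b $ i}}"

definition rectangle :: "(int ^ 'd) set \<Rightarrow> bool" where
  "rectangle R \<longleftrightarrow> (\<exists>a b. (\<forall>i. a $ i \<le> b $ i) \<and> R = box_int a b)"

definition translate_of :: "(int ^ 'd) set \<Rightarrow> (int ^ 'd) set \<Rightarrow> bool" where
  "translate_of R R' \<longleftrightarrow> (\<exists>t. R' = (\<lambda>x. x + t) ` R)"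

definition word :: "(int ^ 'd \<Rightarrow> nat) \<Rightarrow> bool" where
  "word w \<longleftrightarrow> (\<forall>g. w g \<in> {0, 1})"

definition ones :: "(int ^ 'd \<Rightarrow> nat) \<Rightarrow> (int ^ 'd) set" where
  "ones w = {g. w g = 1}"

definition balanced_word :: "(int ^ 'd \<Rightarrow> nat) \<Rightarrow> bool" where
  "balanced_word w \<longleftrightarrow> word w \<and>
     (\<exists>M::real. M > 0 \<and>
       (\<forall>R R'. rectangle R \<and> rectangle R' \<and> translate_of R R' \<longrightarrow>
          \<bar>real (card (ones w \<inter> R)) - real (card (ones w \<inter> R'))\<bar> \<le> M))"

text \<open>
  Rectangles are finite, so \<^const>\<open>card\<close> is the true cardinality throughout. Finitely many members
  of a sequence with \<open>|R\<^sub>n| \<rightarrow> \<infinity>\<close> may be empty; there the quotient is \<open>0\<close> by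
  convention, which does not affect the limit.
\<close>

definition has_density :: "(int ^ 'd \<Rightarrow> nat) \<Rightarrow> real \<Rightarrow> bool" where
  "has_density w a \<longleftrightarrow>
     (\<forall>R :: nat \<Rightarrow> (int ^ 'd) set.
        (\<forall>n. rectangle (R n)) \<longrightarrow>
        filterlim (\<lambda>n. card (R n)) at_top sequentially \<longrightarrow>
        (\<lambda>n. real (card (ones w \<inter> R n)) / real (card (R n))) \<longlonglongrightarrow> a)"

end

theory Submission
  imports Defs
begin

text \<open>
  Put \<open>F x = f (x\<^sub>1 + \<dots> + x\<^sub>d)\<close>. The hypothesis says that the mixed difference
  \<open>\<Delta>\<^sub>1 \<dots> \<Delta>\<^sub>d F\<close> equals \<open>a - w\<close> for a word \<open>w\<close>. Telescoping in each coordinate, its sum over a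
  rectangle is an alternating sum of the values of \<open>F\<close> at the \<open>2\<^sup>d\<close> corners, hence bounded. So
  \<open>|S\<^sub>w \<inter> R| = a |R| + O(1)\<close> uniformly in \<open>R\<close>, which gives both balance and density.
\<close>

text \<open>The recursive form is chosen so that summing over one coordinate telescopes and lowers
  the order by exactly one.\<close>

fun fwd_diff :: "nat \<Rightarrow> (int \<Rightarrow> 'a::ab_group_add) \<Rightarrow> int \<Rightarrow> 'a" where
  "fwd_diff 0 f m = f m"
| "fwd_diff (Suc n) f m = fwd_diff n f (m + 1) - fwd_diff n f m"

text \<open>Links the recursion to the binomial sum of the hypothesis, by Pascal's rule.\<close>

lemma fwd_diff_eq_sum:
  fixes f :: "int \<Rightarrow> 'a::comm_ring_1"
  shows "fwd_diff n f m = (\<Sum>i=0..n. (-1) ^ (n - i) * of_nat (n choose i) * f (m + int i))"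
proof (induction n arbitrary: m)
  case 0
  show ?case by simp
next
  case (Suc n)
  let ?c = "\<lambda>k i. (-1) ^ (k - i) * of_nat (k choose i) :: 'a"
  have split: "(\<Sum>i=0..Suc n. ?c (Suc n) i * f (m + int i))
      = ?c (Suc n) 0 * f m + (\<Sum>i=0..n. ?c (Suc n) (Suc i) * f (m + int (Suc i)))"
    by (simp only: sum.atLeast0_atMost_Suc_shift o_def) simp
  \<comment> \<open>For \<open>i < n\<close> the sign flips between exponents \<open>n - i\<close>
    and \<open>n - Suc i\<close>. At \<open>i = n\<close> truncated subtraction spoils this, but
    \<open>n choose Suc n\<close> is 0.\<close>
  have pascal: "?c (Suc n) (Suc i) = ?c n i - ?c n (Suc i)" if "i \<le> n" for i
  proof (cases "i = n")
    case False
    then have "n - i = Suc (n - Suc i)" using that by simp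
    then show ?thesis by (simp add: algebra_simps)
  qed (simp add: binomial_eq_0)
  \<comment> \<open>The range is one longer than needed: the top term vanishes, and both sums on the
    right of \<open>pascal\<close> can then run over \<open>0..n\<close>.\<close>
  have "(\<Sum>i=0..Suc n. ?c n i * f (m + int i))
      = ?c n 0 * f m + (\<Sum>i=0..n. ?c n (Suc i) * f (m + int (Suc i)))"
    by (simp only: sum.atLeast0_atMost_Suc_shift o_def) simp
  then have shift: "(\<Sum>i=0..n. ?c n (Suc i) * f (m + int (Suc i)))
      = (\<Sum>i=0..n. ?c n i * f (m + int i)) - ?c n 0 * f m"
    by (simp add: binomial_eq_0 algebra_simps)
  have "(\<Sum>i=0..n. ?c (Suc n) (Suc i) * f (m + int (Suc i)))
      = (\<Sum>i=0..n. ?c n i * f (m + int (Suc i))) - (\<Sum>i=0..n. ?c n (Suc i) * f (m + int (Suc i)))"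
    unfolding sum_subtractf[symmetric]
    by (rule sum.cong) (simp_all only: pascal atLeastAtMost_iff left_diff_distrib)
  then show ?case
    unfolding split shift by (simp add: Suc.IH add_ac)
qed

lemma sum_telescope_int:
  fixes g :: "int \<Rightarrow> 'a::ab_group_add"
  assumes "a \<le> b"
  shows "(\<Sum>y\<in>{a..<b}. g (y + 1) - g y) = g b - g a"
  using assms
proof (induction b rule: int_ge_induct)
  case base
  show ?case by simp
next
  case (step b)
  then have "{a..<b + 1} = insert b {a..<b}" by auto
  with step show ?case by simp
qed

lemma sum_PiE_insert:
  assumes "j \<notin> I"
  shows "sum h (PiE (insert j I) S) = (\<Sum>y\<in>S j. \<Sum>x\<in>PiE I S. h (x(j := y)))"
proof -
  have "sum h (PiE (insert j I) S) = (\<Sum>(y, x)\<in>S j \<times> PiE I S. h (x(j := y)))"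
    unfolding PiE_insert_eq using inj_combinator[OF assms, of S]
    by (simp add: sum.reindex o_def case_prod_unfold)
  then show ?thesis by (simp add: sum.cartesian_product)
qed

text \<open>Induction on the index set: summing out one coordinate leaves a difference of two sums
  of the same kind over the remaining ones, which doubles the bound. The offset \<open>m\<close>
  must be arbitrary, since it absorbs the two endpoints.\<close>

lemma abs_sum_fwd_diff_PiE_le:
  fixes f :: "int \<Rightarrow> real"
  assumes "finite I" and "\<And>i. i \<in> I \<Longrightarrow> l i \<le> u i" and f: "\<And>m. \<bar>f m\<bar> \<le> C"
  shows "\<bar>\<Sum>x\<in>PiE I (\<lambda>i. {l i..<u i}). fwd_diff (card I) f (m + (\<Sum>i\<in>I. x i))\<bar>
    \<le> 2 ^ card I * C"
  using assms(1,2)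
proof (induction I arbitrary: m rule: finite_induct)
  case empty
  show ?case using f by simp
next
  case (insert j I)
  let ?P = "PiE I (\<lambda>i. {l i..<u i})"
  define T where "T m = (\<Sum>x\<in>?P. fwd_diff (card I) f (m + (\<Sum>i\<in>I. x i)))" for m
  have T: "\<bar>T m\<bar> \<le> 2 ^ card I * C" for m
    unfolding T_def using insert.IH insert.prems by simp
  have upd: "(\<Sum>i\<in>insert j I. (x(j := y)) i) = y + (\<Sum>i\<in>I. x i)" for x y
  proof -
    have "(\<Sum>i\<in>I. (x(j := y)) i) = (\<Sum>i\<in>I. x i)"
      using insert.hyps by (intro sum.cong) auto
    then show ?thesis using insert.hyps by simp
  qed
  \<comment> \<open>Coordinate \<open>j\<close> enters only through the offset, so the outermost
    difference of \<open>fwd_diff\<close> becomes a difference of \<open>T\<close> in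
    \<open>y\<close>.\<close>
  have "(\<Sum>x\<in>PiE (insert j I) (\<lambda>i. {l i..<u i}).
           fwd_diff (card (insert j I)) f (m + (\<Sum>i\<in>insert j I. x i)))
      = (\<Sum>y\<in>{l j..<u j}. T (m + (y + 1)) - T (m + y))"
    unfolding sum_PiE_insert[OF insert.hyps(2)] upd T_def
    using insert.hyps by (simp add: sum_subtractf add_ac)
  also have "\<dots> = T (m + u j) - T (m + l j)"
    using insert.prems by (intro sum_telescope_int) simp
  also have "\<bar>\<dots>\<bar> \<le> 2 * (2 ^ card I * C)"
    using T[of "m + u j"] T[of "m + l j"] by linarith
  finally show ?case using insert.hyps by simp
qed

text \<open>Passes from vectors to functions on an index set, where induction on the number of
  coordinates is possible.\<close>

lemma sum_box_int:
  fixes l u :: "int ^ 'd::finite"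
  shows "sum h (box_int l u) = (\<Sum>x\<in>PiE UNIV (\<lambda>i. {l $ i..<u $ i}). h (vec_lambda x))"
  by (rule sum.reindex_bij_witness[where i = vec_lambda and j = vec_nth])
    (auto simp: box_int_def)

lemma finite_box_int: "finite (box_int l (u :: int ^ 'd::finite))"
proof -
  have "box_int l u = vec_lambda ` PiE UNIV (\<lambda>i. {l $ i..<u $ i})"
    by (auto simp: box_int_def image_iff intro!: bexI[of _ "vec_nth _"])
  then show ?thesis by (simp add: finite_PiE)
qed

lemma card_translate_of:
  assumes "translate_of R R'"
  shows "card R' = card R"
  using assms by (auto simp: translate_of_def card_image)

text \<open>Translates have equal cardinality, so the main terms \<open>a * card R\<close>
  cancel.\<close>

lemma balanced_word_if_bounded_discrepancy:
  fixes w :: "int ^ 'd::finite \<Rightarrow> nat"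
  assumes "word w"
    and K: "\<And>R. rectangle R \<Longrightarrow> \<bar>real (card (ones w \<inter> R)) - a * real (card R)\<bar> \<le> K"
  shows "balanced_word w"
  unfolding balanced_word_def
\<comment> \<open>The triangle inequality gives \<open>2 * K\<close>; the absolute value and the 1
  make the constant strictly positive.\<close>
proof (intro conjI exI[of _ "2 * \<bar>K\<bar> + 1"] allI impI)
  fix R R' :: "(int ^ 'd) set"
  assume R: "rectangle R \<and> rectangle R' \<and> translate_of R R'"
  then have "card R' = card R" using card_translate_of by blast
  then show "\<bar>real (card (ones w \<inter> R)) - real (card (ones w \<inter> R'))\<bar> \<le> 2 * \<bar>K\<bar> + 1"
    using K[of R] K[of R'] R by simp
qed (use assms(1) in auto)

lemma has_density_if_bounded_discrepancy:
  fixes w :: "int ^ 'd::finite \<Rightarrow> nat"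
  assumes K: "\<And>R. rectangle R \<Longrightarrow> \<bar>real (card (ones w \<inter> R)) - a * real (card R)\<bar> \<le> K"
  shows "has_density w a"
  unfolding has_density_def
proof (intro allI impI)
  fix R :: "nat \<Rightarrow> (int ^ 'd) set"
  assume R: "\<forall>n. rectangle (R n)" and lim: "filterlim (\<lambda>n. card (R n)) at_top sequentially"
  have "filterlim (\<lambda>n. real (card (R n))) at_top sequentially"
    using filterlim_compose[OF filterlim_real_sequentially lim] .
  then have lim0: "(\<lambda>n. K / real (card (R n))) \<longlonglongrightarrow> 0"
    by (intro tendsto_divide_0[OF tendsto_const] filterlim_at_top_imp_at_infinity)
  \<comment> \<open>Discards the empty rectangles, for which the quotient is 0 by
    convention.\<close>
  have "eventually (\<lambda>n. card (R n) \<ge> 1) sequentially"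
    using lim by (simp add: filterlim_at_top)
  then have "eventually (\<lambda>n. norm (real (card (ones w \<inter> R n)) / real (card (R n)) - a)
      \<le> K / real (card (R n))) sequentially"
  proof (eventually_elim)
    case (elim n)
    then have "real (card (ones w \<inter> R n)) / real (card (R n)) - a
        = (real (card (ones w \<inter> R n)) - a * real (card (R n))) / real (card (R n))"
      by (simp add: field_simps)
    then show ?case
      using K[of "R n"] R by (simp add: abs_divide divide_right_mono)
  qed
  then have "(\<lambda>n. real (card (ones w \<inter> R n)) / real (card (R n)) - a) \<longlonglongrightarrow> 0"
    by (rule Lim_null_comparison[OF _ lim0])
  then show "(\<lambda>n. real (card (ones w \<inter> R n)) / real (card (R n))) \<longlonglongrightarrow> a"
    by (simp add: LIM_zero_iff)
qed

theorem theorem2p2: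
  fixes a :: real and f :: "int \<Rightarrow> real"
  assumes "0 \<le> a" and "a \<le> 1"
    and "bounded (range f)"
    and "\<And>m::int. (\<Sum>i=0..CARD('d::finite).
           (-1) ^ (CARD('d) - i) * real (CARD('d) choose i) * f (m + int i)) \<in> {a, a - 1}"
  shows "\<exists>w :: int ^ 'd \<Rightarrow> nat. word w \<and> balanced_word w \<and> has_density w a"
proof -
  obtain C where C: "\<And>m. \<bar>f m\<bar> \<le> C"
    using assms(3) by (auto simp: bounded_iff)
  let ?D = "\<lambda>x :: int ^ 'd. fwd_diff CARD('d) f (\<Sum>i\<in>UNIV. x $ i)"
  \<comment> \<open>The two admissible values \<open>a\<close> and \<open>a - 1\<close> of
    \<open>?D x\<close> give letters 0 and 1, that is \<open>w x = a - ?D x\<close>.\<close>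
  define w :: "int ^ 'd \<Rightarrow> nat" where "w x = (if ?D x = a then 0 else 1)" for x
  have D: "?D x \<in> {a, a - 1}" for x
    unfolding fwd_diff_eq_sum using assms(4) by simp
  have w: "real (w x) = a - ?D x" for x
    using D[of x] by (auto simp: w_def)
  have word: "word w" by (simp add: word_def w_def)
  have "\<bar>real (card (ones w \<inter> R)) - a * real (card R)\<bar> \<le> 2 ^ CARD('d) * C" if rect: "rectangle R" for R
  proof -
    obtain l u where lu: "\<And>i. l $ i \<le> u $ i" and R: "R = box_int l u"
      using rect unfolding rectangle_def by blast
    have fin: "finite R" unfolding R by (rule finite_box_int)
    have "real (card (ones w \<inter> R)) = (\<Sum>x\<in>ones w \<inter> R. real (w x))"
      by (simp add: ones_def)
    also have "\<dots> = (\<Sum>x\<in>R. real (w x))"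
      using fin by (intro sum.mono_neutral_left) (auto simp: ones_def w_def split: if_splits)
    also have "\<dots> = a * real (card R) - (\<Sum>x\<in>R. ?D x)"
      by (simp add: w sum_subtractf)
    finally have "\<bar>real (card (ones w \<inter> R)) - a * real (card R)\<bar> = \<bar>\<Sum>x\<in>R. ?D x\<bar>"
      by simp
    also have "\<dots> \<le> 2 ^ CARD('d) * C"
      using abs_sum_fwd_diff_PiE_le[of UNIV "vec_nth l" "vec_nth u" f C 0] lu C
      unfolding R sum_box_int by simp
    finally show ?thesis .
  qed
  then show ?thesis
    using word balanced_word_if_bounded_discrepancy has_density_if_bounded_discrepancy by blast
qed

end
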